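(* Let $\mathrm{V}$ be a finite vertex set, let $\mathfrak{G}$ be the class of all undirected graphs over $\mathrm{V}$, and let $\mathcal{L}=(\mathfrak{G},\preceq)$ be the poset with $\mathcal{G}_1\preceq\mathcal{G}_2$ if and only if $\mathcal{M}^{\mathrm{o}}_{\mathrm{UG}}(\mathcal{G}_1)\subseteq\mathcal{M}^{\mathrm{o}}_{\mathrm{UG}}(\mathcal{G}_2)$. Then: 1. The least element of $\mathcal{L}$ is the empty graph and the greatest element is the full (complete) graph. 2. $\mathcal{L}$ is graded with $\mathrm{rank}(\mathcal{G})$ equal to the number of edges of $\mathcal{G}$. 3. $\mathcal{G}_1\lessdot\mathcal{G}_2$ if and only if $\mathcal{G}_1$ is a subgraph of $\mathcal{G}_2$ with exactly one fewer edge. 4. $\mathcal{L}$ is a lattice (both a meet and a join semi-lattice). 5. $\mathcal{L}$ is both lower and upper semimodular.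
   Context: Undirected graphs are simple (no loops, at most one edge per pair); a subgraph here is over the same vertex set with a subset of the edges. Model: for each $v\in\mathrm{V}$ let $\mathcal{X}_v$ be a measurable space with a $\sigma$-finite measure $\mu_v$ that is nondegenerate (there are two disjoint measurable sets of positive $\mu_v$-measure); $\mathcal{X}=\prod_v\mathcal{X}_v$, $\mu=\prod_v\mu_v$. $\mathcal{M}^{\mathrm{o}}_{+}$ is the set of probability laws $P$ of $X=(X_v)_{v\in\mathrm{V}}$ on $\mathcal{X}$ that are absolutely continuous with respect to $\mu$ with density $p>0$ $\mu$-a.e. For an undirected graph $\mathcal{G}$, $\mathcal{M}^{\mathrm{o}}_{\mathrm{UG}}(\mathcal{G})$ is the set of $P\in\mathcal{M}^{\mathrm{o}}_{+}$ such that for all disjoint $\mathrm{A},\mathrm{B},\mathrm{C}\subset\mathrm{V}$, if $\mathrm{C}$ separates $\mathrm{A}$ and $\mathrm{B}$ in $\mathcal{G}$, then $X_{\mathrm{A}}$ and $X_{\mathrm{B}}$ are conditionally independent given $X_{\mathrm{C}}$ under $P$. Poset terms: $x\lessdot y$ ($y$ covers $x$) if $x\prec y$ with nothing strictly between. A poset is connected if any two elements are joined by a sequence whose consecutive elements are in a covering relation. A connected poset is graded with rank function $\mathrm{rank}:\mathfrak{G}\to\mathbb{N}$ if $x\lessdot y$ implies $\mathrm{rank}(y)=\mathrm{rank}(x)+1$, and $\mathrm{rank}(x)=0$ for some minimal element $x$. Meet (join) semi-lattice: every two elements have a greatest lower bound (least upper bound). Lower semimodular: whenever $z$ covers $x$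 and $y$ with $x\ne y$, some $w$ is covered by both $x$ and $y$. Upper semimodular: whenever $z$ is covered by $x$ and $y$ with $x\neq y$, some $w$ covers both $x$ and $y$. *)

theory Defs
  imports "HOL-Algebra.Lattice" "HOL-Probability.Probability"
begin

section \<open>Undirected graphs\<close>

text \<open>A simple undirected graph over the fixed vertex set \<open>V\<close> is represented by its edge set, a set
  of two-element subsets of \<open>V\<close>. The empty graph is \<open>{}\<close>, the subgraph relation on
  graphs over \<open>V\<close> is \<open>\<subseteq>\<close>, and the number of edges is \<open>card\<close>.\<close>

definition complete_ug :: "'v set \<Rightarrow> 'v set set" where
  "complete_ug V = {e. e \<subseteq> V \<and> card e = 2}"

definition ugraphs :: "'v set \<Rightarrow> 'v set set set" where
  "ugraphs V = {E. E \<subseteq> complete_ug V}"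

definition ug_path :: "'v set set \<Rightarrow> 'v list \<Rightarrow> bool" where
  "ug_path E p \<longleftrightarrow> p \<noteq> [] \<and> distinct p \<and> successively (\<lambda>u v. {u, v} \<in> E) p"

definition separates :: "'v set set \<Rightarrow> 'v set \<Rightarrow> 'v set \<Rightarrow> 'v set \<Rightarrow> bool" where
  "separates E A B C \<longleftrightarrow>
     (\<forall>p. ug_path E p \<and> hd p \<in> A \<and> last p \<in> B \<longrightarrow> set p \<inter> C \<noteq> {})"


section \<open>Conditional independence\<close>

definition cond_prob_given ::
  "'w measure \<Rightarrow> 'z measure \<Rightarrow> ('w \<Rightarrow> 'z) \<Rightarrow> 'w set \<Rightarrow> 'w \<Rightarrow> real" where
  "cond_prob_given P U Z F =
     real_cond_exp P (vimage_algebra (space P) Z U) (indicator F)"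

definition cond_indep_rv ::
  "'w measure \<Rightarrow> 'x measure \<Rightarrow> ('w \<Rightarrow> 'x) \<Rightarrow> 'y measure \<Rightarrow> ('w \<Rightarrow> 'y) \<Rightarrow>
     'z measure \<Rightarrow> ('w \<Rightarrow> 'z) \<Rightarrow> bool" where
  "cond_indep_rv P S X T Y U Z \<longleftrightarrow>
     (\<forall>F\<in>sets S. \<forall>G\<in>sets T.
        AE w in P.
          cond_prob_given P U Z ((X -` F \<inter> space P) \<inter> (Y -` G \<inter> space P)) w =
          cond_prob_given P U Z (X -` F \<inter> space P) w *
          cond_prob_given P U Z (Y -` G \<inter> space P) w)"


section \<open>Graphical models\<close>

text \<open>\<open>M v\<close> bundles the measurable space \<open>space (M v)\<close> of the variable at \<open>v\<close> with its base
  measure, so that the product space with the product base measure is \<open>PiM V M\<close>. The random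
  vector is the identity on this space, and its subvector indexed by \<open>A\<close> is restriction
  to \<open>A\<close>.\<close>

definition nondegenerate :: "'a measure \<Rightarrow> bool" where
  "nondegenerate N \<longleftrightarrow>
     (\<exists>S\<in>sets N. \<exists>T\<in>sets N. S \<inter> T = {} \<and> emeasure N S > 0 \<and> emeasure N T > 0)"

definition positive_laws :: "'v set \<Rightarrow> ('v \<Rightarrow> 'a measure) \<Rightarrow> ('v \<Rightarrow> 'a) measure set" where
  "positive_laws V M =
     {P. prob_space P \<and>
         (\<exists>p\<in>borel_measurable (PiM V M).
            (AE x in PiM V M. p x > (0::ennreal)) \<and> P = density (PiM V M) p)}"

definition subvector_cond_indep ::
  "('v \<Rightarrow> 'a measure) \<Rightarrow> ('v \<Rightarrow> 'a) measure \<Rightarrow> 'v set \<Rightarrow> 'v set \<Rightarrow> 'v set \<Rightarrow> bool" where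
  "subvector_cond_indep M P A B C \<longleftrightarrow>
     cond_indep_rv P (PiM A M) (\<lambda>x. restrict x A) (PiM B M) (\<lambda>x. restrict x B)
       (PiM C M) (\<lambda>x. restrict x C)"

definition ug_model ::
  "'v set \<Rightarrow> ('v \<Rightarrow> 'a measure) \<Rightarrow> 'v set set \<Rightarrow> ('v \<Rightarrow> 'a) measure set" where
  "ug_model V M E =
     {P \<in> positive_laws V M.
        \<forall>A B C. A \<subseteq> V \<and> B \<subseteq> V \<and> C \<subseteq> V \<and>
          A \<inter> B = {} \<and> A \<inter> C = {} \<and> B \<inter> C = {} \<and> separates E A B C \<longrightarrow>
          subvector_cond_indep M P A B C}"

definition ug_poset :: "'v set \<Rightarrow> ('v \<Rightarrow> 'a measure) \<Rightarrow> 'v set set gorder" where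
  "ug_poset V M =
     \<lparr>carrier = ugraphs V, eq = (=), le = (\<lambda>E1 E2. ug_model V M E1 \<subseteq> ug_model V M E2)\<rparr>"


section \<open>Graded and semimodular posets\<close>

text \<open>\<open>covered_by L x y\<close> means that \<open>y\<close> covers \<open>x\<close>.\<close>

definition covered_by :: "('a, 'b) gorder_scheme \<Rightarrow> 'a \<Rightarrow> 'a \<Rightarrow> bool" where
  "covered_by L x y \<longleftrightarrow>
     x \<in> carrier L \<and> y \<in> carrier L \<and> x \<sqsubset>\<^bsub>L\<^esub> y \<and>
     \<not> (\<exists>z\<in>carrier L. x \<sqsubset>\<^bsub>L\<^esub> z \<and> z \<sqsubset>\<^bsub>L\<^esub> y)"

definition connected_order :: "('a, 'b) gorder_scheme \<Rightarrow> bool" where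
  "connected_order L \<longleftrightarrow>
     (\<forall>x\<in>carrier L. \<forall>y\<in>carrier L. (\<lambda>a b. covered_by L a b \<or> covered_by L b a)\<^sup>*\<^sup>* x y)"

definition minimal_in :: "('a, 'b) gorder_scheme \<Rightarrow> 'a \<Rightarrow> bool" where
  "minimal_in L x \<longleftrightarrow> x \<in> carrier L \<and> \<not> (\<exists>y\<in>carrier L. y \<sqsubset>\<^bsub>L\<^esub> x)"

definition graded_with_rank :: "('a, 'b) gorder_scheme \<Rightarrow> ('a \<Rightarrow> nat) \<Rightarrow> bool" where
  "graded_with_rank L rk \<longleftrightarrow>
     partial_order L \<and> connected_order L \<and>
     (\<forall>x y. covered_by L x y \<longrightarrow> rk y = rk x + 1) \<and>
     (\<exists>x. minimal_in L x \<and> rk x = 0)"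

definition lower_semimodular :: "('a, 'b) gorder_scheme \<Rightarrow> bool" where
  "lower_semimodular L \<longleftrightarrow>
     (\<forall>x y z. covered_by L x z \<and> covered_by L y z \<and> x \<noteq> y \<longrightarrow>
        (\<exists>w. covered_by L w x \<and> covered_by L w y))"

definition upper_semimodular :: "('a, 'b) gorder_scheme \<Rightarrow> bool" where
  "upper_semimodular L \<longleftrightarrow>
     (\<forall>x y z. covered_by L z x \<and> covered_by L z y \<and> x \<noteq> y \<longrightarrow>
        (\<exists>w. covered_by L x w \<and> covered_by L y w))"

end

theory Submission
  imports Defs
begin

text \<open>Everything reduces to showing that the inclusion of models is the inclusion of edge sets, because
  the order is then that of a finite powerset. Deleting edges creates separations, so models grow
  with the graph. Conversely, suppose that \<open>{u, v}\<close> is an edge of \<open>E1\<close> but not of \<open>E2\<close>. Pass from the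
  base measures to equivalent probability measures, and tilt their product by the density
  \<open>1 + dev u S * dev v T / 2\<close>, where \<open>dev\<close> is a centred indicator. This couples only the coordinates \<open>u\<close>
  and \<open>v\<close>, so the law lies in the model of \<open>E1\<close>; but \<open>X u\<close> and \<open>X v\<close> stay dependent given all other
  coordinates, which separate \<open>u\<close> from \<open>v\<close> in \<open>E2\<close>.\<close>

section \<open>The order of a finite powerset\<close>

text \<open>Agreement of the order with inclusion is required only on \<open>Pow K\<close>, because
  inclusion of models is compared with inclusion of edge sets only for graphs over the vertex
  set.\<close>

locale powerset_order =
  fixes L :: "'e set gorder" (structure) and K :: "'e set"
  assumes finite_ground: "finite K"
    and carrier_eq: "carrier L = Pow K"
    and eq_iff: "x .= y \<longleftrightarrow> x = y"
    and le_iff: "x \<in> Pow K \<Longrightarrow> y \<in> Pow K \<Longrightarrow> x \<sqsubseteq> y \<longleftrightarrow> x \<subseteq> y"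
begin

lemma partial_order: "partial_order L"
  by unfold_locales (auto simp: carrier_eq eq_iff le_iff fun_eq_iff)

section \<open>Joins and meets\<close>

lemma least_Upper:
  assumes "x \<subseteq> K" "y \<subseteq> K"
  shows "least L (x \<union> y) (Upper L {x, y})"
proof -
  have "z \<in> Upper L {x, y} \<longleftrightarrow> z \<subseteq> K \<and> x \<subseteq> z \<and> y \<subseteq> z" for z
    using assms le_iff[of x z] le_iff[of y z] unfolding Upper_def carrier_eq by blast
  then have "Upper L {x, y} = {z. z \<subseteq> K \<and> x \<subseteq> z \<and> y \<subseteq> z}"
    by (simp add: set_eq_iff)
  moreover have "x \<union> y \<sqsubseteq> z" if "z \<subseteq> K" "x \<subseteq> z" "y \<subseteq> z" for z
    using that assms le_iff[of "x \<union> y" z] by simp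
  ultimately show ?thesis
    using assms by (simp add: least_def carrier_eq Pow_def Collect_mono_iff)
qed

lemma greatest_Lower:
  assumes "x \<subseteq> K" "y \<subseteq> K"
  shows "greatest L (x \<inter> y) (Lower L {x, y})"
proof -
  have "z \<in> Lower L {x, y} \<longleftrightarrow> z \<subseteq> K \<and> z \<subseteq> x \<and> z \<subseteq> y" for z
    using assms le_iff[of z x] le_iff[of z y] unfolding Lower_def carrier_eq by blast
  then have "Lower L {x, y} = {z. z \<subseteq> K \<and> z \<subseteq> x \<and> z \<subseteq> y}"
    by (simp add: set_eq_iff)
  moreover have "z \<sqsubseteq> x \<inter> y" if "z \<subseteq> K" "z \<subseteq> x" "z \<subseteq> y" for z
    using that assms le_iff[of z "x \<inter> y"] by (simp add: le_infI1)
  ultimately show ?thesis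
    using assms by (simp add: greatest_def carrier_eq Pow_def Collect_mono_iff le_infI1)
qed

lemma lower_semilattice: "lower_semilattice L"
  by (intro lower_semilattice.intro partial_order lower_semilattice_axioms.intro exI)
    (rule greatest_Lower, simp_all add: carrier_eq)

lemma upper_semilattice: "upper_semilattice L"
  by (intro upper_semilattice.intro partial_order upper_semilattice_axioms.intro exI)
    (rule least_Upper, simp_all add: carrier_eq)

lemma lattice: "lattice L"
  using upper_semilattice lower_semilattice by (rule lattice.intro)

lemma least_empty: "least L {} (carrier L)"
  and greatest_ground: "greatest L K (carrier L)"
  by (auto simp: least_def greatest_def carrier_eq le_iff)

section \<open>Covers and the rank function\<close>

lemma lless_iff: "x \<in> Pow K \<Longrightarrow> y \<in> Pow K \<Longrightarrow> x \<sqsubset> y \<longleftrightarrow> x \<subset> y"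
  by (auto simp: lless_def eq_iff le_iff)

text \<open>If \<open>y\<close> contains \<open>x\<close> properly and \<open>e\<close> lies in the
  difference, then \<open>insert e x\<close> sits weakly between them, so a cover leaves no room for
  a second new element.\<close>

lemma covered_by_iff:
  "covered_by L x y \<longleftrightarrow> (\<exists>e. y \<subseteq> K \<and> e \<notin> x \<and> y = insert e x)"
proof
  assume cov: "covered_by L x y"
  then have sub: "x \<subseteq> K" "y \<subseteq> K" and "x \<subset> y"
    by (auto simp: covered_by_def carrier_eq lless_iff)
  then obtain e where e: "e \<in> y" "e \<notin> x" by auto
  have "insert e x = y"
  proof (rule ccontr)
    assume "insert e x \<noteq> y"
    with e \<open>x \<subset> y\<close> have "x \<subset> insert e x" "insert e x \<subset> y" by auto
    moreover from this sub have "x \<in> Pow K" "insert e x \<in> Pow K" "y \<in> Pow K" by blast+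
    ultimately have "insert e x \<in> carrier L" "x \<sqsubset> insert e x" "insert e x \<sqsubset> y"
      by (simp_all only: carrier_eq lless_iff)
    with cov show False by (auto simp: covered_by_def)
  qed
  with e sub show "\<exists>e. y \<subseteq> K \<and> e \<notin> x \<and> y = insert e x" by blast
qed (auto simp: covered_by_def carrier_eq lless_iff)

lemma covered_by_iff_card:
  assumes "x \<subseteq> K" "y \<subseteq> K"
  shows "covered_by L x y \<longleftrightarrow> x \<subseteq> y \<and> card y = card x + 1"
proof
  have fin: "finite x" "finite y"
    using assms finite_ground by (auto intro: finite_subset)
  show "covered_by L x y \<Longrightarrow> x \<subseteq> y \<and> card y = card x + 1"
    using fin by (auto simp: covered_by_iff)
  assume *: "x \<subseteq> y \<and> card y = card x + 1"
  then have "card (y - x) = 1"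
    using fin by (simp add: card_Diff_subset)
  then obtain e where "y - x = {e}"
    by (auto simp: card_1_singleton_iff)
  with * assms show "covered_by L x y"
    unfolding covered_by_iff by blast
qed

text \<open>Any two sets are joined through \<open>{}\<close>: remove the elements of one, then add
  those of the other, one at a time.\<close>

lemma connected_order: "connected_order L"
proof -
  let ?R = "(\<lambda>a b. covered_by L a b \<or> covered_by L b a)\<^sup>*\<^sup>*"
  have "finite x \<Longrightarrow> x \<subseteq> K \<Longrightarrow> ?R {} x \<and> ?R x {}" for x
  proof (induction x rule: finite_induct)
    case (insert e x)
    then have "covered_by L x (insert e x)"
      by (auto simp: covered_by_iff)
    with insert show ?case
      by (metis (mono_tags, lifting) converse_rtranclp_into_rtranclp insert_subset
          rtranclp.rtrancl_into_rtrancl)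
  qed simp
  then have "?R x {}" "?R {} x" if "x \<in> carrier L" for x
    using that finite_subset[OF _ finite_ground] by (simp_all add: carrier_eq)
  then show ?thesis
    unfolding connected_order_def by (blast intro: rtranclp_trans)
qed

lemma graded_with_rank: "graded_with_rank L card"
proof -
  have "minimal_in L {}"
    by (auto simp: minimal_in_def carrier_eq lless_iff)
  moreover have "covered_by L x y \<Longrightarrow> card y = card x + 1" for x y
    using covered_by_iff_card[of x y] by (auto simp: covered_by_def carrier_eq)
  ultimately show ?thesis
    using partial_order connected_order by (auto simp: graded_with_rank_def)
qed

section \<open>Semimodularity\<close>

lemma covered_by_iff_remove: "covered_by L x y \<longleftrightarrow> (\<exists>e\<in>y. y \<subseteq> K \<and> x = y - {e})"
  unfolding covered_by_iff by (metis Diff_insert_absorb Diff_iff insertI1 insert_Diff)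

text \<open>Two distinct sets covered by \<open>z\<close> arise by deleting distinct elements
  \<open>e\<close> and \<open>f\<close>; deleting both gives the witness.\<close>

lemma lower_semimodular: "lower_semimodular L"
  unfolding lower_semimodular_def
proof (intro allI impI, elim conjE)
  fix x y z assume "covered_by L x z" "covered_by L y z" "x \<noteq> y"
  then obtain e f where ef: "z \<subseteq> K" "e \<in> z" "x = z - {e}" "f \<in> z" "y = z - {f}"
    unfolding covered_by_iff_remove by metis
  with \<open>x \<noteq> y\<close> have "f \<in> x" "e \<in> y" by auto
  moreover from ef have "x \<subseteq> K" "y \<subseteq> K" "z - {e, f} = x - {f}" "z - {e, f} = y - {e}" by auto
  ultimately have "covered_by L (z - {e, f}) x" "covered_by L (z - {e, f}) y"
    unfolding covered_by_iff_remove by metis+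
  then show "\<exists>w. covered_by L w x \<and> covered_by L w y" by blast
qed

text \<open>Two distinct covers of \<open>z\<close> add distinct elements, so their union exceeds
  each of them by exactly one element.\<close>

lemma upper_semimodular: "upper_semimodular L"
  unfolding upper_semimodular_def
proof (intro allI impI, elim conjE)
  fix x y z assume "covered_by L z x" "covered_by L z y" "x \<noteq> y"
  then obtain e f where *: "x \<subseteq> K" "y \<subseteq> K" "e \<notin> z" "x = insert e z" "f \<notin> z" "y = insert f z"
    unfolding covered_by_iff by blast
  with \<open>x \<noteq> y\<close> have "f \<notin> x" "insert f x = x \<union> y" "e \<notin> y" "insert e y = x \<union> y"
    by auto
  moreover from * have "x \<union> y \<subseteq> K" by blast
  ultimately have "covered_by L x (x \<union> y)" "covered_by L y (x \<union> y)"
    unfolding covered_by_iff by (intro exI[of _ f] exI[of _ e]; simp)+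
  then show "\<exists>w. covered_by L x w \<and> covered_by L y w" by blast
qed

end


section \<open>Separation\<close>

lemma ug_path_mono: "ug_path E1 p \<Longrightarrow> E1 \<subseteq> E2 \<Longrightarrow> ug_path E2 p"
  unfolding ug_path_def by (auto elim!: successively_mono)

lemma separates_mono: "separates E2 A B C \<Longrightarrow> E1 \<subseteq> E2 \<Longrightarrow> separates E1 A B C"
  using ug_path_mono unfolding separates_def by metis

text \<open>The second vertex of a path from \<open>u\<close> to \<open>v\<close> is a neighbour of
  \<open>u\<close>, hence neither \<open>u\<close> nor \<open>v\<close>, and so it already lies in
  the separating set.\<close>

lemma separates_non_adjacent:
  assumes "E \<subseteq> complete_ug V" "u \<noteq> v" "{u, v} \<notin> E"
  shows "separates E {u} {v} (V - {u, v})"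
  unfolding separates_def
proof (intro allI impI)
  fix p assume p: "ug_path E p \<and> hd p \<in> {u} \<and> last p \<in> {v}"
  \<comment> \<open>The case rule splits lists into empty, singleton and longer ones; a singleton
    would force \<open>u = v\<close>.\<close>
  then obtain w q where q: "p = u # w # q"
    using \<open>u \<noteq> v\<close> by (cases p rule: remdups_adj.cases) (auto simp: ug_path_def)
  with p have "{u, w} \<in> E" "w \<noteq> u" by (auto simp: ug_path_def)
  with assms have "w \<in> V - {u, v}" by (auto simp: complete_ug_def)
  with q show "set p \<inter> (V - {u, v}) \<noteq> {}" by auto
qed

text \<open>The edge itself, traversed in either direction, is a path that \<open>C\<close> cannot
  meet when both ends lie in \<open>A\<close> and \<open>B\<close>.\<close>

lemma separates_single_edgeD:
  assumes sep: "separates {{u, v}} A B C" and "u \<noteq> v" and disj: "A \<inter> C = {}" "B \<inter> C = {}"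
  shows "\<not> (u \<in> A \<and> v \<in> B)" "\<not> (v \<in> A \<and> u \<in> B)"
proof -
  have "ug_path {{u, v}} [u, v]" "ug_path {{u, v}} [v, u]"
    using \<open>u \<noteq> v\<close> by (auto simp: ug_path_def insert_commute)
  then have "u \<in> A \<Longrightarrow> v \<in> B \<Longrightarrow> {u, v} \<inter> C \<noteq> {}" "v \<in> A \<Longrightarrow> u \<in> B \<Longrightarrow> {v, u} \<inter> C \<noteq> {}"
    using sep[unfolded separates_def, rule_format, of "[u, v]"]
      sep[unfolded separates_def, rule_format, of "[v, u]"] by simp_all
  with disj show "\<not> (u \<in> A \<and> v \<in> B)" "\<not> (v \<in> A \<and> u \<in> B)"
    by blast+
qed


section \<open>Conditional independence\<close>

lemma cond_prob_given_cong_sets: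
  "sets U = sets U' \<Longrightarrow> cond_prob_given P U Z F = cond_prob_given P U' Z F"
  by (simp add: cond_prob_given_def vimage_algebra_def)

text \<open>Conditional independence uses the component measures only through their sigma-algebras.
  This allows the base measures to be exchanged for equivalent probability measures.\<close>

lemma subvector_cond_indep_cong_sets:
  assumes "\<And>v. v \<in> A \<union> B \<union> C \<Longrightarrow> sets (M v) = sets (N v)"
  shows "subvector_cond_indep M P A B C \<longleftrightarrow> subvector_cond_indep N P A B C"
proof -
  have "sets (PiM A M) = sets (PiM A N)" "sets (PiM B M) = sets (PiM B N)"
    "sets (PiM C M) = sets (PiM C N)"
    using assms by (auto intro!: sets_PiM_cong)
  then show ?thesis
    by (simp only: subvector_cond_indep_def cond_indep_rv_def
        cond_prob_given_cong_sets[of "PiM C M" "PiM C N"])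
qed

section \<open>Conditional probabilities under a probability measure\<close>

context prob_space
begin

lemma sigma_finite_subalgebra_vimage:
  assumes "Z \<in> measurable M U"
  shows "sigma_finite_subalgebra M (vimage_algebra (space M) Z U)"
proof -
  have "subalgebra M (vimage_algebra (space M) Z U)"
    using assms by (auto simp: subalgebra_def measurable_space
        sets_vimage_algebra2[of Z "space M" U, OF funcsetI[OF measurable_space[OF assms]]])
  then show ?thesis
    by (intro finite_measure_subalgebra_is_sigma_finite finite_measure_subalgebra.intro
        finite_measure_subalgebra_axioms.intro finite_measure_axioms)
qed

lemma integrable_indicator_event: "F \<in> events \<Longrightarrow> integrable M (indicator F :: 'a \<Rightarrow> real)"
  by (intro integrable_real_indicator) (auto simp: emeasure_eq_measure)

lemma integral_cond_prob_given:
  assumes "Z \<in> measurable M U" "F \<in> events"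
  shows "(\<integral>x. cond_prob_given M U Z F x \<partial>M) = prob F"
  unfolding cond_prob_given_def
  using sigma_finite_subalgebra.real_cond_exp_int(2)[OF sigma_finite_subalgebra_vimage[OF assms(1)]
      integrable_indicator_event[OF assms(2)]] assms(2) by simp

lemma cond_prob_given_scale:
  assumes Z: "Z \<in> measurable M U" and [measurable]: "F \<in> events" "F' \<in> events"
    and eq: "\<And>H. H \<in> sets U \<Longrightarrow> prob (F \<inter> (Z -` H \<inter> space M)) = c * prob (F' \<inter> (Z -` H \<inter> space M))"
  shows "AE x in M. cond_prob_given M U Z F x = c * cond_prob_given M U Z F' x"
proof -
  let ?S = "vimage_algebra (space M) Z U"
  interpret sigma_finite_subalgebra M ?S
    using Z by (rule sigma_finite_subalgebra_vimage)
  note int = integrable_indicator_event[OF \<open>F \<in> events\<close>] integrable_indicator_event[OF \<open>F' \<in> events\<close>]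
  show ?thesis
    unfolding cond_prob_given_def
  proof (rule real_cond_exp_charact)
    fix A assume A: "A \<in> sets ?S"
    then obtain H where H: "H \<in> sets U" "A = Z -` H \<inter> space M"
      using sets_vimage_algebra2[of Z "space M" U, OF funcsetI[OF measurable_space[OF Z]]] by auto
    then have [measurable]: "A \<in> events"
      using Z by auto
    have set_int: "(\<integral>x\<in>A. indicator G x \<partial>M) = prob (G \<inter> A)" if "G \<in> events" for G
      using that sets.sets_into_space[OF that]
      by (simp add: set_lebesgue_integral_def Int_absorb2 Int_commute flip: indicator_inter_arith)
    have "(\<integral>x\<in>A. indicator F x \<partial>M) = c * prob (F' \<inter> A)"
      using eq[OF H(1)] by (simp add: set_int flip: H(2))
    also have "\<dots> = c * (\<integral>x\<in>A. real_cond_exp M ?S (indicator F') x \<partial>M)"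
      using real_cond_exp_intA[OF int(2) A] by (simp only: set_int[OF \<open>F' \<in> events\<close>])
    finally show "(\<integral>x\<in>A. indicator F x \<partial>M) =
        (\<integral>x\<in>A. c * real_cond_exp M ?S (indicator F') x \<partial>M)"
      by simp
  qed (use int real_cond_exp_int(1) in auto)
qed

text \<open>This is the scaling lemma with the sure event as \<open>F'\<close>, whose conditional
  probability is 1 almost everywhere.\<close>

lemma cond_prob_given_const:
  assumes Z: "Z \<in> measurable M U" and "F \<in> events"
    and "\<And>H. H \<in> sets U \<Longrightarrow> prob (F \<inter> (Z -` H \<inter> space M)) = c * prob (Z -` H \<inter> space M)"
  shows "AE x in M. cond_prob_given M U Z F x = c"
proof -
  let ?S = "vimage_algebra (space M) Z U"
  interpret sigma_finite_subalgebra M ?S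
    using Z by (rule sigma_finite_subalgebra_vimage)
  have "AE x in M. cond_prob_given M U Z F x = c * cond_prob_given M U Z (space M) x"
    using assms by (intro cond_prob_given_scale) (simp_all add: Int_left_absorb Int_commute)
  \<comment> \<open>Being measurable for the conditioning sigma-algebra, this indicator is its own
    conditional expectation.\<close>
  moreover have "indicat_real (space M) \<in> borel_measurable ?S"
    by (intro borel_measurable_indicator) (metis sets.top space_vimage_algebra)
  then have "AE x in M. cond_prob_given M U Z (space M) x = indicator (space M) x"
    unfolding cond_prob_given_def by (intro real_cond_exp_F_meas integrable_indicator_event) auto
  ultimately show ?thesis
    by (auto simp: AE_space elim: AE_mp)
qed

lemma cond_indep_rv_commute:
  "cond_indep_rv M S X T Y U Z \<Longrightarrow> cond_indep_rv M T Y S X U Z"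
  unfolding cond_indep_rv_def by (simp add: Int_commute mult.commute)

text \<open>The hypothesis makes \<open>Y\<close> independent of the pair \<open>(X, Z)\<close>.
  Conditioning on \<open>Z\<close> then leaves the probability of a \<open>Y\<close>-event constant,
  and intersecting with that event merely multiplies the conditional probability of an
  \<open>X\<close>-event by this constant.\<close>

lemma cond_indep_rvI_indep:
  assumes [measurable]: "X \<in> measurable M S" "Y \<in> measurable M T" and Z: "Z \<in> measurable M U"
    and eq: "\<And>F G H. F \<in> sets S \<Longrightarrow> G \<in> sets T \<Longrightarrow> H \<in> sets U \<Longrightarrow>
      prob ((X -` F \<inter> space M) \<inter> (Y -` G \<inter> space M) \<inter> (Z -` H \<inter> space M)) =
      prob (Y -` G \<inter> space M) * prob ((X -` F \<inter> space M) \<inter> (Z -` H \<inter> space M))"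
  shows "cond_indep_rv M S X T Y U Z"
  unfolding cond_indep_rv_def
proof (intro ballI)
  fix F G assume F[measurable]: "F \<in> sets S" and G[measurable]: "G \<in> sets T"
  let ?X = "X -` F \<inter> space M" and ?Y = "Y -` G \<inter> space M"
  \<comment> \<open>Choosing the whole space as the \<open>X\<close>-event turns the hypothesis into
    independence of \<open>Y\<close> and \<open>Z\<close>.\<close>
  have "X -` space S \<inter> space M = space M"
    using measurable_space[OF assms(1)] by auto
  then have "prob (?Y \<inter> (Z -` H \<inter> space M)) = prob ?Y * prob (Z -` H \<inter> space M)"
    if "H \<in> sets U" for H
    using eq[OF sets.top G that] by (simp add: Int_left_absorb Int_commute Int_absorb2)
  then have "AE x in M. cond_prob_given M U Z ?Y x = prob ?Y"
    by (intro cond_prob_given_const Z) auto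
  moreover have "AE x in M. cond_prob_given M U Z (?X \<inter> ?Y) x = prob ?Y * cond_prob_given M U Z ?X x"
    using eq[OF F G] by (intro cond_prob_given_scale Z) auto
  ultimately show "AE x in M. cond_prob_given M U Z (?X \<inter> ?Y) x =
      cond_prob_given M U Z ?X x * cond_prob_given M U Z ?Y x"
    by eventually_elim simp
qed

end


section \<open>A tilted product law\<close>

text \<open>The joint law of the coordinates is the product of their laws. The criterion used
  requires a nonempty index set, hence the case split.\<close>

lemma (in product_prob_space) indep_vars_component:
  assumes "finite I"
  shows "indep_vars M (\<lambda>i x. x i) I"
proof (cases "I = {}")
  case True
  then show ?thesis unfolding P.indep_vars_def P.indep_sets_def by simp
next
  case False
  have "distr (PiM I M) (PiM I M) (\<lambda>x. \<lambda>i\<in>I. x i) = distr (PiM I M) (PiM I M) (\<lambda>x. x)"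
    by (intro distr_cong) (auto simp: space_PiM)
  also have "\<dots> = PiM I (\<lambda>i. distr (PiM I M) (M i) (\<lambda>x. x i))"
    by (auto simp: PiM_component intro!: PiM_cong)
  finally show ?thesis
    using False by (subst indep_vars_iff_distr_eq_PiM') auto
qed


text \<open>Disjoint blocks of coordinates are independent, and the bounds supply
  integrability.\<close>

lemma (in product_prob_space) integral_mult_restrict:
  fixes f h :: "('i \<Rightarrow> 'a) \<Rightarrow> real"
  assumes "finite I" "A \<subseteq> I" "B \<subseteq> I" "A \<inter> B = {}"
    and f[measurable]: "f \<in> borel_measurable (PiM A M)" "\<And>x. \<bar>f x\<bar> \<le> c"
    and h[measurable]: "h \<in> borel_measurable (PiM B M)" "\<And>x. \<bar>h x\<bar> \<le> d"
  shows "(\<integral>x. f (restrict x A) * h (restrict x B) \<partial>PiM I M) =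
    (\<integral>x. f (restrict x A) \<partial>PiM I M) * (\<integral>x. h (restrict x B) \<partial>PiM I M)"
proof (rule indep_var_lebesgue_integral)
  have [measurable]: "(\<lambda>x. restrict x A) \<in> measurable (PiM I M) (PiM A M)"
    "(\<lambda>x. restrict x B) \<in> measurable (PiM I M) (PiM B M)"
    using assms by (auto intro: measurable_restrict_subset)
  show "integrable (PiM I M) (\<lambda>x. f (restrict x A))"
    using f(2) by (intro integrable_const_bound[of _ c]) auto
  show "integrable (PiM I M) (\<lambda>x. h (restrict x B))"
    using h(2) by (intro integrable_const_bound[of _ d]) auto
  show "indep_var borel (\<lambda>x. f (restrict x A)) borel (\<lambda>x. h (restrict x B))"
    using indep_var_compose[OF indep_var_restrict[OF indep_vars_component[OF \<open>finite I\<close>]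
        \<open>A \<inter> B = {}\<close> \<open>A \<subseteq> I\<close> \<open>B \<subseteq> I\<close>] f(1) h(1)]
    by (simp add: comp_def)
qed

locale perturbed_product = product_prob_space N V
  for N :: "'v \<Rightarrow> 'a measure" and V :: "'v set" +
  fixes u v :: 'v and S T :: "'a set"
  assumes finite_V: "finite V" and uv: "u \<in> V" "v \<in> V" "u \<noteq> v"
    and S[measurable]: "S \<in> sets (N u)" and T[measurable]: "T \<in> sets (N v)"
begin

abbreviation Q :: "('v \<Rightarrow> 'a) measure" where
  "Q \<equiv> PiM V N"

definition dev :: "'v \<Rightarrow> 'a set \<Rightarrow> ('v \<Rightarrow> 'a) \<Rightarrow> real" where
  "dev w E x = indicator E (x w) - measure (N w) E"

text \<open>The product of the deviations lies between -1 and 1, so halving it keeps the density at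
  least 1/2 and hence strictly positive.\<close>

definition tilt :: "('v \<Rightarrow> 'a) \<Rightarrow> real" where
  "tilt x = 1 + dev u S x * dev v T x / 2"

definition law :: "('v \<Rightarrow> 'a) measure" where
  "law = density Q (\<lambda>x. ennreal (tilt x))"

lemma measurable_dev[measurable]:
  "w \<in> A \<Longrightarrow> E \<in> sets (N w) \<Longrightarrow> dev w E \<in> borel_measurable (PiM A N)"
  unfolding dev_def
  by (intro borel_measurable_diff borel_measurable_const
      measurable_compose[OF measurable_component_singleton borel_measurable_indicator])

lemma measurable_tilt[measurable]:
  "u \<in> A \<Longrightarrow> v \<in> A \<Longrightarrow> tilt \<in> borel_measurable (PiM A N)"
  unfolding tilt_def by measurable

lemma dev_restrict: "w \<in> A \<Longrightarrow> dev w E (restrict x A) = dev w E x"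
  by (simp add: dev_def)

lemma tilt_restrict: "u \<in> A \<Longrightarrow> v \<in> A \<Longrightarrow> tilt (restrict x A) = tilt x"
  by (simp add: tilt_def dev_restrict)

lemma abs_dev_le: "\<bar>dev w E x\<bar> \<le> 1"
proof -
  have "\<bar>indicator E y - m\<bar> \<le> 1" if "0 \<le> m" "m \<le> 1" for m :: real and y
    using that by (auto simp: indicator_def)
  then show ?thesis
    by (simp add: dev_def)
qed

lemma abs_dev_dev_le: "\<bar>dev u S x * dev v T x\<bar> \<le> 1"
  unfolding abs_mult by (intro mult_le_one abs_dev_le abs_ge_zero)

lemma tilt_pos: "tilt x > 0" and abs_tilt_le: "\<bar>tilt x\<bar> \<le> 2"
  using abs_dev_dev_le[of x] by (auto simp: tilt_def)

lemma measurable_restrict_Q[measurable]: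
  "A \<subseteq> V \<Longrightarrow> (\<lambda>x. restrict x A) \<in> measurable Q (PiM A N)"
  by (rule measurable_restrict_subset)

section \<open>Integrals against the deviations and the tilt\<close>

lemma integral_indicator_component:
  assumes "w \<in> V" "E \<in> sets (N w)"
  shows "(\<integral>x. indicator E (x w) \<partial>Q) = measure (N w) E"
  using integral_distr[of "\<lambda>x. x w" Q "N w" "indicator E :: 'a \<Rightarrow> real"] assms
  by (simp add: PiM_component sets.Int_space_eq2)

lemma integrable_bounded:
  fixes f :: "('v \<Rightarrow> 'a) \<Rightarrow> real"
  shows "f \<in> borel_measurable Q \<Longrightarrow> (\<And>x. \<bar>f x\<bar> \<le> c) \<Longrightarrow> integrable Q f"
  by (intro integrable_const_bound[of _ c]) auto

lemma integral_dev: "w \<in> V \<Longrightarrow> E \<in> sets (N w) \<Longrightarrow> (\<integral>x. dev w E x \<partial>Q) = 0"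
  unfolding dev_def
  by (subst Bochner_Integration.integral_diff)
    (auto intro!: integrable_bounded[of _ 1] simp: integral_indicator_component P.prob_space)

text \<open>The deviation at a coordinate outside \<open>A\<close> has mean zero and is independent
  of the block \<open>A\<close>.\<close>

lemma integral_mult_dev:
  fixes f :: "('v \<Rightarrow> 'a) \<Rightarrow> real"
  assumes "A \<subseteq> V" "f \<in> borel_measurable (PiM A N)" "\<And>x. \<bar>f x\<bar> \<le> c"
    and "w \<in> V - A" "E \<in> sets (N w)"
  shows "(\<integral>x. f (restrict x A) * dev w E x \<partial>Q) = 0"
  using integral_mult_restrict[of A "{w}" f c "dev w E" 1] assms finite_V
  by (simp add: abs_dev_le dev_restrict integral_dev)

text \<open>The deviation at \<open>w'\<close> is absorbed into a function of the block
  \<open>insert w' A\<close>, which still omits \<open>w\<close>; this works whether or not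
  \<open>w'\<close> lies in \<open>A\<close>.\<close>

lemma integral_mult_dev_dev:
  fixes f :: "('v \<Rightarrow> 'a) \<Rightarrow> real"
  assumes A: "A \<subseteq> V" "w \<in> V - A" "w' \<in> V" "w \<noteq> w'" and [measurable]: "E \<in> sets (N w)" "E' \<in> sets (N w')"
    and f: "f \<in> borel_measurable (PiM A N)" "\<And>x. \<bar>f x\<bar> \<le> c"
  shows "(\<integral>x. f (restrict x A) * (dev w' E' x * dev w E x) \<partial>Q) = 0"
proof -
  let ?B = "insert w' A"
  have [measurable]: "(\<lambda>x. restrict x A) \<in> measurable (PiM ?B N) (PiM A N)"
    by (intro measurable_restrict_subset) auto
  have "(\<integral>x. f (restrict (restrict x ?B) A) * dev w' E' (restrict x ?B) * dev w E x \<partial>Q) = 0"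
  proof (rule integral_mult_dev)
    show "(\<lambda>y. f (restrict y A) * dev w' E' y) \<in> borel_measurable (PiM ?B N)"
      using f(1) by measurable
    show "\<bar>f (restrict y A) * dev w' E' y\<bar> \<le> c" for y
      using mult_mono[OF f(2) abs_dev_le] f(2)[THEN order_trans[OF abs_ge_zero]]
      by (simp add: abs_mult)
  qed (use A in auto)
  then show ?thesis
    by (simp add: dev_restrict Int_absorb1 subset_insertI mult.assoc)
qed

text \<open>The tilt is invisible to any block of coordinates that omits \<open>u\<close> or
  \<open>v\<close>, because the correction term then carries an independent deviation of mean
  zero.\<close>

lemma integral_mult_tilt:
  fixes f :: "('v \<Rightarrow> 'a) \<Rightarrow> real"
  assumes "A \<subseteq> V" "\<not> {u, v} \<subseteq> A" and f[measurable]: "f \<in> borel_measurable (PiM A N)" "\<And>x. \<bar>f x\<bar> \<le> c"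
  shows "(\<integral>x. f (restrict x A) * tilt x \<partial>Q) = (\<integral>x. f (restrict x A) \<partial>Q)"
proof -
  let ?f = "\<lambda>x. f (restrict x A)" and ?d = "\<lambda>x. dev u S x * dev v T x"
  have [measurable]: "?f \<in> borel_measurable Q"
    using \<open>A \<subseteq> V\<close> by measurable
  have "(\<integral>x. ?f x * ?d x \<partial>Q) = 0"
  \<comment> \<open>One of \<open>u\<close> and \<open>v\<close> lies outside \<open>A\<close>, and
    its deviation is the one that integrates to zero.\<close>
  proof (cases "v \<in> A")
    case False
    with integral_mult_dev_dev[of A v u T S f c] assms uv S T show ?thesis by auto
  next
    case True
    with integral_mult_dev_dev[of A u v S T f c] assms uv S T show ?thesis
      by (simp add: mult.commute)
  qed
  moreover have "(\<integral>x. ?f x * tilt x \<partial>Q) = (\<integral>x. ?f x + ?f x * ?d x / 2 \<partial>Q)"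
    by (simp add: tilt_def algebra_simps)
  moreover have "integrable Q ?f"
    using f(2) by (intro integrable_bounded) auto
  moreover have "integrable Q (\<lambda>x. ?f x * ?d x / 2)"
  proof (rule integrable_bounded)
    show "\<bar>?f x * ?d x / 2\<bar> \<le> c / 2" for x
      using mult_mono[OF f(2) abs_dev_dev_le] f(2)[THEN order_trans[OF abs_ge_zero]]
      by (simp add: abs_mult)
  qed (use uv in measurable)
  ultimately show ?thesis
    by simp
qed

section \<open>Conditional independence and dependence under the tilted law\<close>

lemma sets_law[measurable_cong]: "sets law = sets Q"
  and space_law: "space law = space Q"
  by (simp_all add: law_def)

lemma measure_law: "E \<in> sets Q \<Longrightarrow> measure law E = (\<integral>x. indicator E x * tilt x \<partial>Q)"
  using integral_real_density[of tilt Q "indicator E"] uv tilt_pos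
  by (simp add: law_def less_imp_le mult.commute sets.Int_space_eq2)

lemma integral_tilt: "(\<integral>x. tilt x \<partial>Q) = 1"
  using integral_mult_tilt[of "{}" "\<lambda>_. 1" 1] by (simp add: P.prob_space)

lemma prob_space_law: "prob_space law"
proof (rule prob_spaceI)
  have "emeasure law (space law) = (\<integral>\<^sup>+x. ennreal (tilt x) \<partial>Q)"
    using uv by (simp add: law_def emeasure_density cong: nn_integral_cong)
  also have "\<dots> = 1"
    using uv tilt_pos by (subst nn_integral_eq_integral)
      (auto intro!: integrable_bounded[OF _ abs_tilt_le] simp: integral_tilt less_imp_le)
  finally show "emeasure law (space law) = 1" .
qed

text \<open>Since \<open>B\<close> avoids \<open>u\<close> and \<open>v\<close>, the density depends
  only on coordinates outside \<open>B\<close>. The block \<open>B\<close> thus stays independent of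
  all the others under \<open>law\<close>.\<close>

lemma subvector_cond_indep_law:
  assumes "A \<subseteq> V" "B \<subseteq> V" "C \<subseteq> V" "A \<inter> B = {}" "B \<inter> C = {}" "u \<notin> B" "v \<notin> B"
  shows "subvector_cond_indep N law A B C"
  unfolding subvector_cond_indep_def
proof (rule prob_space.cond_indep_rvI_indep[OF prob_space_law])
  fix F G H assume [measurable]: "F \<in> sets (PiM A N)" "G \<in> sets (PiM B N)" "H \<in> sets (PiM C N)"
  let ?D = "V - B"
  let ?X = "(\<lambda>x. restrict x A) -` F \<inter> space law" and ?Y = "(\<lambda>x. restrict x B) -` G \<inter> space law"
    and ?Z = "(\<lambda>x. restrict x C) -` H \<inter> space law"
  \<comment> \<open>Everything except the event on block \<open>B\<close> is collected here,
    including the density; it is a function of the coordinates in \<open>V - B\<close>.\<close>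
  define h :: "('v \<Rightarrow> 'a) \<Rightarrow> real"
    where "h y = indicator F (restrict y A) * indicator H (restrict y C) * tilt y" for y
  have sub: "A \<subseteq> ?D" "C \<subseteq> ?D" "u \<in> ?D" "v \<in> ?D"
    using assms uv by auto
  have [measurable]: "(\<lambda>x. restrict x A) \<in> measurable (PiM ?D N) (PiM A N)"
    "(\<lambda>x. restrict x C) \<in> measurable (PiM ?D N) (PiM C N)"
    using sub by (auto intro: measurable_restrict_subset)
  have h_restrict: "h (restrict x ?D) = h x" for x
    using sub by (simp add: h_def tilt_restrict Int_absorb1)
  have [measurable]: "h \<in> borel_measurable (PiM ?D N)"
    unfolding h_def using sub by measurable
  have abs_h: "\<bar>h x\<bar> \<le> 2" for x
    using abs_tilt_le[of x] by (auto simp: h_def indicator_def)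
  have [measurable]: "?X \<in> sets Q" "?Y \<in> sets Q" "?Z \<in> sets Q"
    unfolding space_law using assms(1-3) by measurable
  then have ev: "?X \<inter> ?Y \<inter> ?Z \<in> sets Q" "?X \<inter> ?Z \<in> sets Q" by blast+
  have Y: "(\<integral>x. indicator G (restrict x B) * k (restrict x ?D) \<partial>Q) =
      (\<integral>x. indicator G (restrict x B) \<partial>Q) * (\<integral>x. k (restrict x ?D) \<partial>Q)"
    if "k \<in> borel_measurable (PiM ?D N)" "\<And>x. \<bar>k x\<bar> \<le> 2" for k :: "('v \<Rightarrow> 'a) \<Rightarrow> real"
    using that assms finite_V by (intro integral_mult_restrict[where c = 1 and d = 2]) auto
  have "measure law (?X \<inter> ?Y \<inter> ?Z) = (\<integral>x. indicator G (restrict x B) * h (restrict x ?D) \<partial>Q)"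
    unfolding measure_law[OF ev(1)] h_restrict
    by (auto intro!: Bochner_Integration.integral_cong simp: h_def space_law indicator_def)
  also have "\<dots> = (\<integral>x. indicator G (restrict x B) \<partial>Q) * (\<integral>x. h x \<partial>Q)"
    using Y[of h] abs_h by (simp add: h_restrict)
  also have "(\<integral>x. h x \<partial>Q) = measure law (?X \<inter> ?Z)"
    unfolding measure_law[OF ev(2)]
    by (auto intro!: Bochner_Integration.integral_cong simp: h_def space_law indicator_def)
  \<comment> \<open>Under \<open>Q\<close> the tilt is independent of the block \<open>B\<close> and
    has integral 1, so it may be inserted to recover a probability under \<open>law\<close>.\<close>
  also have "(\<integral>x. indicator G (restrict x B) \<partial>Q) = (\<integral>x. indicator G (restrict x B) * tilt x \<partial>Q)"
    using Y[of tilt] sub abs_tilt_le by (simp add: tilt_restrict integral_tilt)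
  also have "\<dots> = measure law ?Y"
    unfolding measure_law[OF \<open>?Y \<in> sets Q\<close>]
    by (auto intro!: Bochner_Integration.integral_cong simp: space_law indicator_def)
  finally show "measure law (?X \<inter> ?Y \<inter> ?Z) = measure law ?Y * measure law (?X \<inter> ?Z)" .
qed (use assms in measurable)

text \<open>The block \<open>insert w C\<close> omits one of \<open>u\<close> and \<open>v\<close>,
  so on it \<open>law\<close> agrees with the product law, under which coordinate \<open>w\<close>
  is independent of \<open>C\<close>.\<close>

lemma cond_prob_given_component:
  assumes w: "w = u \<or> w = v" and [measurable]: "E \<in> sets (N w)" and C: "C \<subseteq> V - {u, v}"
  shows "AE x in law. cond_prob_given law (PiM C N) (\<lambda>x. restrict x C) {x \<in> space Q. x w \<in> E} x =
    measure (N w) E"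
proof (rule prob_space.cond_prob_given_const[OF prob_space_law])
  have [simp]: "w \<in> V" "w \<notin> C" "C \<subseteq> V" "\<not> {u, v} \<subseteq> insert w C" "\<not> {u, v} \<subseteq> C"
    using uv w C by auto
  show "(\<lambda>x. restrict x C) \<in> measurable law (PiM C N)"
    by (simp add: measurable_restrict_Q measurable_cong_sets[OF sets_law refl])
  show "{x \<in> space Q. x w \<in> E} \<in> sets law"
    by measurable
  fix H assume [measurable]: "H \<in> sets (PiM C N)"
  let ?Z = "(\<lambda>x. restrict x C) -` H \<inter> space law" and ?A = "insert w C"
  let ?e = "\<lambda>y. indicator E (y w) :: real" and ?h = "\<lambda>y. indicator H (restrict y C) :: real"
  have [measurable]: "(\<lambda>x. restrict x C) \<in> measurable (PiM ?A N) (PiM C N)"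
    by (intro measurable_restrict_subset) auto
  have [measurable]: "?Z \<in> sets Q" "{x \<in> space Q. x w \<in> E} \<in> sets Q"
    unfolding space_law using \<open>C \<subseteq> V\<close> \<open>w \<in> V\<close> by measurable
  have "measure law ({x \<in> space Q. x w \<in> E} \<inter> ?Z) = (\<integral>x. ?e (restrict x ?A) * ?h (restrict x ?A) * tilt x \<partial>Q)"
    unfolding measure_law[OF sets.Int[OF \<open>{x \<in> space Q. x w \<in> E} \<in> sets Q\<close> \<open>?Z \<in> sets Q\<close>]]
    by (auto intro!: Bochner_Integration.integral_cong simp: space_law indicator_def Int_absorb1 subset_insertI)
  also have "\<dots> = (\<integral>x. ?e (restrict x ?A) * ?h (restrict x ?A) \<partial>Q)"
  proof (rule integral_mult_tilt[where f = "\<lambda>y. ?e y * ?h y" and c = 1])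
    show "(\<lambda>y. ?e y * ?h y) \<in> borel_measurable (PiM ?A N)"
      by measurable
  qed (use uv w C in \<open>auto simp: indicator_def\<close>)
  also have "\<dots> = (\<integral>x. ?e (restrict x {w}) * indicator H (restrict x C) \<partial>Q)"
    by (simp add: Int_absorb1 subset_insertI)
  also have "\<dots> = (\<integral>x. ?e (restrict x {w}) \<partial>Q) * (\<integral>x. indicator H (restrict x C) \<partial>Q)"
    using finite_V by (intro integral_mult_restrict[where c = 1 and d = 1]) auto
  also have "(\<integral>x. ?e (restrict x {w}) \<partial>Q) = measure (N w) E"
    by (simp add: integral_indicator_component)
  \<comment> \<open>The block \<open>C\<close> omits both \<open>u\<close> and \<open>v\<close>, so
    the tilt can be put back at no cost.\<close>
  also have "(\<integral>x. indicator H (restrict x C) \<partial>Q) = (\<integral>x. indicator H (restrict x C) * tilt x \<partial>Q)"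
    using C by (subst integral_mult_tilt[where c = 1]) auto
  also have "\<dots> = measure law ?Z"
    unfolding measure_law[OF \<open>?Z \<in> sets Q\<close>]
    by (auto intro!: Bochner_Integration.integral_cong simp: space_law indicator_def)
  finally show "measure law ({x \<in> space Q. x w \<in> E} \<inter> ?Z) = measure (N w) E * measure law ?Z" .
qed

text \<open>Given \<open>C\<close>, the two events have constant conditional probabilities.
  Conditional independence would make their joint conditional probability the product of these
  constants, and integration would make the events independent. The tilt, however, raises the
  probability of their intersection.\<close>

lemma not_subvector_cond_indep_law:
  assumes C: "C \<subseteq> V - {u, v}" and s: "0 < measure (N u) S" "measure (N u) S < 1"
    and t: "0 < measure (N v) T" "measure (N v) T < 1"
  shows "\<not> subvector_cond_indep N law {u} {v} C"
proof
  assume indep: "subvector_cond_indep N law {u} {v} C"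
  interpret law: prob_space law by (rule prob_space_law)
  \<comment> \<open>Events about one-element subvectors, since conditional independence is stated
    for these; their preimages are \<open>?X\<close> and \<open>?Y\<close>.\<close>
  let ?S = "{y \<in> space (PiM {u} N). y u \<in> S}" and ?T = "{y \<in> space (PiM {v} N). y v \<in> T}"
  let ?X = "{x \<in> space Q. x u \<in> S}" and ?Y = "{x \<in> space Q. x v \<in> T}"
  let ?cp = "cond_prob_given law (PiM C N) (\<lambda>x. restrict x C)"
  let ?s = "measure (N u) S" and ?t = "measure (N v) T"
  have ST[measurable]: "?S \<in> sets (PiM {u} N)" "?T \<in> sets (PiM {v} N)"
    by measurable
  have [measurable]: "?X \<in> sets Q" "?Y \<in> sets Q"
    using uv by measurable
  have pre: "(\<lambda>x. restrict x {u}) -` ?S \<inter> space law = ?X" "(\<lambda>x. restrict x {v}) -` ?T \<inter> space law = ?Y"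
    using uv by (auto simp: space_law space_PiM)
  have "AE x in law. ?cp (?X \<inter> ?Y) x = ?cp ?X x * ?cp ?Y x"
    using indep[unfolded subvector_cond_indep_def cond_indep_rv_def, rule_format, OF ST]
    unfolding pre .
  moreover have "AE x in law. ?cp ?X x = ?s" "AE x in law. ?cp ?Y x = ?t"
    using cond_prob_given_component C S T by auto
  ultimately have "AE x in law. ?cp (?X \<inter> ?Y) x = ?s * ?t"
    by eventually_elim simp
  then have "(\<integral>x. ?cp (?X \<inter> ?Y) x \<partial>law) = (\<integral>x. ?s * ?t \<partial>law)"
    by (intro integral_cong_AE) (auto simp: cond_prob_given_def)
  moreover have "(\<integral>x. ?cp (?X \<inter> ?Y) x \<partial>law) = measure law (?X \<inter> ?Y)"
    using C by (intro law.integral_cond_prob_given)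
      (auto simp: sets_law measurable_cong_sets[OF sets_law refl] intro!: measurable_restrict_Q)
  ultimately have "measure law (?X \<inter> ?Y) = ?s * ?t"
    by (simp add: law.prob_space)
  \<comment> \<open>On the intersection both indicators equal 1, so the tilt is constant there and
    only a product probability remains.\<close>
  moreover have "measure law (?X \<inter> ?Y) = (1 + (1 - ?s) * (1 - ?t) / 2) * (?s * ?t)"
  proof -
    let ?S' = "\<lambda>y. indicator S (y u) :: real" and ?T' = "\<lambda>y. indicator T (y v) :: real"
    have "measure law (?X \<inter> ?Y) = (\<integral>x. (1 + (1 - ?s) * (1 - ?t) / 2) * (?S' (restrict x {u}) * ?T' (restrict x {v})) \<partial>Q)"
      unfolding measure_law[OF sets.Int[OF \<open>?X \<in> sets Q\<close> \<open>?Y \<in> sets Q\<close>]]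
      by (rule Bochner_Integration.integral_cong[OF refl]) (auto simp: tilt_def dev_def indicator_def)
    also have "\<dots> = (1 + (1 - ?s) * (1 - ?t) / 2) * ((\<integral>x. ?S' (restrict x {u}) \<partial>Q) * (\<integral>x. ?T' (restrict x {v}) \<partial>Q))"
      using finite_V uv
      by (subst integral_mult_right_zero, subst integral_mult_restrict[where c = 1 and d = 1]) auto
    finally show ?thesis
      using uv by (simp add: integral_indicator_component)
  qed
  ultimately have "(1 - ?s) * (1 - ?t) * (?s * ?t) = 0"
    by (simp add: algebra_simps)
  with s t show False by simp
qed

end


section \<open>Inclusion of graphical models\<close>

text \<open>It suffices to compare the two measures on rectangles, where the integrand factorises
  over the coordinates.\<close>

lemma (in product_sigma_finite) PiM_density:
  assumes "finite I" and N: "product_sigma_finite N"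
    and h[measurable]: "\<And>i. i \<in> I \<Longrightarrow> h i \<in> borel_measurable (M i)"
    and N_eq: "\<And>i. i \<in> I \<Longrightarrow> N i = density (M i) (h i)"
  shows "density (PiM I M) (\<lambda>x. \<Prod>i\<in>I. h i (x i)) = PiM I N"
proof (rule product_sigma_finite.PiM_eqI[OF N \<open>finite I\<close>])
  show "sets (density (PiM I M) (\<lambda>x. \<Prod>i\<in>I. h i (x i))) = sets (PiM I N)"
    using N_eq by (simp cong: sets_PiM_cong)
  fix A assume A: "\<And>i. i \<in> I \<Longrightarrow> A i \<in> sets (N i)"
  then have [measurable]: "\<And>i. i \<in> I \<Longrightarrow> A i \<in> sets (M i)"
    using N_eq by simp
  have [measurable]: "Pi\<^sub>E I A \<in> sets (PiM I M)"
    using \<open>finite I\<close> by (intro sets_PiM_I_finite) auto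
  have "emeasure (density (PiM I M) (\<lambda>x. \<Prod>i\<in>I. h i (x i))) (Pi\<^sub>E I A) =
      (\<integral>\<^sup>+x. (\<Prod>i\<in>I. h i (x i)) * indicator (Pi\<^sub>E I A) x \<partial>PiM I M)"
    by (rule emeasure_density) measurable
  also have "\<dots> = (\<integral>\<^sup>+x. (\<Prod>i\<in>I. h i (x i) * indicator (A i) (x i)) \<partial>PiM I M)"
  proof (rule nn_integral_cong)
    fix x assume "x \<in> space (PiM I M)"
    then have "indicator (Pi\<^sub>E I A) x = (\<Prod>i\<in>I. indicator (A i) (x i) :: ennreal)"
      using \<open>finite I\<close> by (auto simp: space_PiM PiE_iff indicator_def prod_zero_iff)
    then show "(\<Prod>i\<in>I. h i (x i)) * indicator (Pi\<^sub>E I A) x =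
        (\<Prod>i\<in>I. h i (x i) * indicator (A i) (x i))"
      by (simp add: prod.distrib)
  qed
  also have "\<dots> = (\<Prod>i\<in>I. emeasure (N i) (A i))"
    using \<open>finite I\<close> by (subst product_nn_integral_prod) (auto simp: N_eq emeasure_density intro!: prod.cong)
  finally show "emeasure (density (PiM I M) (\<lambda>x. \<Prod>i\<in>I. h i (x i))) (Pi\<^sub>E I A) =
      (\<Prod>i\<in>I. emeasure (N i) (A i))" .
qed

text \<open>Normalising a strictly positive integrable function gives an equivalent probability
  measure. Both disjoint sets keep positive mass under it, so neither has full mass.\<close>

lemma nondegenerate_prob_density:
  assumes "sigma_finite_measure M" "nondegenerate M"
  obtains h :: "'a \<Rightarrow> real" and S where
    "h \<in> borel_measurable M" "\<And>x. 0 < h x" "prob_space (density M h)"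
    "S \<in> sets M" "0 < measure (density M h) S" "measure (density M h) S < 1"
proof -
  interpret sigma_finite_measure M by fact
  obtain f :: "'a \<Rightarrow> real" where [measurable]: "f \<in> borel_measurable M" and f: "\<And>x. 0 < f x" "integrable M f"
    using obtain_positive_integrable_function by metis
  obtain S T where [measurable]: "S \<in> sets M" "T \<in> sets M" and "S \<inter> T = {}"
    and pos: "emeasure M S > 0" "emeasure M T > 0"
    using \<open>nondegenerate M\<close> by (auto simp: nondegenerate_def)
  define c where "c = (\<integral>x. f x \<partial>M)"
  define h where "h x = f x / c" for x
  \<comment> \<open>A vanishing integral of a strictly positive function would make \<open>S\<close>
    a null set.\<close>
  have "c \<noteq> 0"
  proof
    assume "c = 0"
    then have "AE x in M. f x = 0"
      using f by (subst (asm) c_def, subst (asm) integral_nonneg_eq_0_iff_AE) (auto simp: less_imp_le)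
    then have "AE x in M. x \<notin> S"
      by eventually_elim (use f(1) in \<open>simp add: less_imp_neq[symmetric]\<close>)
    then show False
      using pos AE_iff_null_sets[OF \<open>S \<in> sets M\<close>] by auto
  qed
  moreover have "0 \<le> c"
    using f by (auto simp: c_def less_imp_le)
  ultimately have h: "0 < h x" for x
    using f by (simp add: h_def)
  have [measurable]: "h \<in> borel_measurable M"
    unfolding h_def by measurable
  let ?P = "density M h"
  have "(\<integral>\<^sup>+x. ennreal (h x) \<partial>M) = ennreal (\<integral>x. h x \<partial>M)"
    using f h by (intro nn_integral_eq_integral) (auto simp: h_def less_imp_le)
  also have "(\<integral>x. h x \<partial>M) = 1"
    using \<open>c \<noteq> 0\<close> by (simp add: h_def c_def)
  finally interpret P: prob_space ?P
    by (intro prob_spaceI) (simp add: emeasure_density cong: nn_integral_cong)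
  \<comment> \<open>Because \<open>h\<close> is strictly positive, null sets of the new measure are
    null for \<open>M\<close>.\<close>
  have P_pos: "0 < measure ?P E" if "E \<in> sets M" "emeasure M E > 0" for E
  proof (rule ccontr)
    assume "\<not> 0 < measure ?P E"
    then have "E \<in> null_sets ?P"
      using that(1) measure_nonneg[of ?P E]
      by (auto simp: null_sets_def P.emeasure_eq_measure)
    then have "AE x in M. x \<in> E \<longrightarrow> ennreal (h x) = 0"
      by (subst (asm) null_sets_density_iff) auto
    then have "AE x in M. x \<notin> E"
      by eventually_elim (metis ennreal_eq_0_iff h not_le)
    then show False
      using that AE_iff_null_sets[OF that(1)] by auto
  qed
  have "measure ?P S + measure ?P T = measure ?P (S \<union> T)"
    using \<open>S \<inter> T = {}\<close> by (simp add: P.finite_measure_Union)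
  also have "\<dots> \<le> 1"
    by simp
  finally show thesis
    using h P.prob_space_axioms P_pos[OF \<open>S \<in> sets M\<close> pos(1)] P_pos[OF \<open>T \<in> sets M\<close> pos(2)]
    by (intro that[of h S]) auto
qed

lemma ug_model_subset_iff:
  fixes V :: "'v set" and M :: "'v \<Rightarrow> 'a measure"
  assumes fin: "finite V"
    and sf: "\<And>v. v \<in> V \<Longrightarrow> sigma_finite_measure (M v)"
    and nd: "\<And>v. v \<in> V \<Longrightarrow> nondegenerate (M v)"
    and E: "E1 \<subseteq> complete_ug V" "E2 \<subseteq> complete_ug V"
  shows "ug_model V M E1 \<subseteq> ug_model V M E2 \<longleftrightarrow> E1 \<subseteq> E2"
proof
  assume "E1 \<subseteq> E2"
  then show "ug_model V M E1 \<subseteq> ug_model V M E2"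
    by (auto simp: ug_model_def dest: separates_mono)
next
  assume sub: "ug_model V M E1 \<subseteq> ug_model V M E2"
  show "E1 \<subseteq> E2"
  proof (rule ccontr)
    assume "\<not> E1 \<subseteq> E2"
    then obtain e where "e \<in> E1" "e \<notin> E2" by blast
    moreover from this E obtain u v where e: "e = {u, v}" "u \<noteq> v"
      by (auto simp: complete_ug_def card_2_iff)
    ultimately have edge: "u \<in> V" "v \<in> V" "{u, v} \<in> E1" "{u, v} \<notin> E2"
      using E by (auto simp: complete_ug_def)
    \<comment> \<open>A single predicate for all requirements lets the density and the event be
      chosen together as functions of the vertex.\<close>
    define good where "good w h S \<longleftrightarrow> h \<in> borel_measurable (M w) \<and> (\<forall>x. 0 < h x) \<and>
        prob_space (density (M w) (\<lambda>x. ennreal (h x))) \<and> S \<in> sets (M w) \<and>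
        0 < measure (density (M w) (\<lambda>x. ennreal (h x))) S \<and>
        measure (density (M w) (\<lambda>x. ennreal (h x))) S < 1" for w h S
    have "\<exists>h S. good w h S" if "w \<in> V" for w
      using nondegenerate_prob_density[OF sf[OF that] nd[OF that]] unfolding good_def by metis
    then obtain h S where "\<And>w. w \<in> V \<Longrightarrow> good w (h w) (S w)"
      by metis
    then have h: "\<And>w. w \<in> V \<Longrightarrow> h w \<in> borel_measurable (M w)" "\<And>w x. w \<in> V \<Longrightarrow> 0 < h w x"
        "\<And>w. w \<in> V \<Longrightarrow> prob_space (density (M w) (\<lambda>x. ennreal (h w x)))"
      and S_good: "\<And>w. w \<in> V \<Longrightarrow> S w \<in> sets (M w)"
        "\<And>w. w \<in> V \<Longrightarrow> 0 < measure (density (M w) (\<lambda>x. ennreal (h w x))) (S w)"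
        "\<And>w. w \<in> V \<Longrightarrow> measure (density (M w) (\<lambda>x. ennreal (h w x))) (S w) < 1"
      unfolding good_def by blast+
    \<comment> \<open>The product locales constrain every index; nothing is assumed about \<open>M\<close> outside \<open>V\<close>.\<close>
    define M' where "M' w = (if w \<in> V then M w else count_space {undefined})" for w
    define N where "N w = (if w \<in> V then density (M w) (\<lambda>x. ennreal (h w x)) else count_space {undefined})" for w
    have "prob_space (N w)" for w
      using h(3) by (auto simp: N_def intro!: prob_spaceI)
    then interpret product_prob_space N V
      by (rule product_prob_spaceI)
    interpret perturbed_product N V u v "S u" "S v"
      using fin edge e S_good by unfold_locales (auto simp: N_def)
    have sets_N: "w \<in> V \<Longrightarrow> sets (N w) = sets (M w)" for w
      by (simp add: N_def)
    have "sigma_finite_measure (M' w)" for w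
      using sf by (auto simp: M'_def intro: sigma_finite_measure_count_space_finite)
    then interpret M': product_sigma_finite M'
      by unfold_locales (auto simp: sigma_finite_measure_def)
    have PiM_M': "PiM V M' = PiM V M"
      by (intro PiM_cong) (auto simp: M'_def)
    have Q: "PiM V N = density (PiM V M) (\<lambda>x. \<Prod>w\<in>V. ennreal (h w (x w)))"
      using fin h product_sigma_finite_axioms
      by (subst M'.PiM_density[symmetric, where h = "\<lambda>w x. ennreal (h w x)" and N = N])
        (auto simp: M'_def N_def PiM_M')
    have [measurable]: "(\<lambda>x. h w (x w)) \<in> borel_measurable (PiM V M)" if "w \<in> V" for w
      using h(1) that by measurable
    have H_measurable: "(\<lambda>x. \<Prod>w\<in>V. ennreal (h w (x w))) \<in> borel_measurable (PiM V M)"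
      by measurable
    have tilt_measurable: "tilt \<in> borel_measurable (PiM V M)"
      using measurable_tilt[of V] edge by (simp cong: measurable_cong_sets add: Q)
    \<comment> \<open>Relative to the original base measure, the density is the product of the
      vertex densities and the tilt, all of them strictly positive.\<close>
    have law_eq: "law = density (PiM V M) (\<lambda>x. (\<Prod>w\<in>V. ennreal (h w (x w))) * ennreal (tilt x))"
      unfolding law_def Q
      by (intro density_density_eq H_measurable measurable_compose[OF tilt_measurable measurable_ennreal])
    have "law \<in> positive_laws V M"
      unfolding positive_laws_def
    proof (intro CollectI conjI bexI prob_space_law)
      show "law = density (PiM V M) (\<lambda>x. (\<Prod>w\<in>V. ennreal (h w (x w))) * ennreal (tilt x))"
        by (rule law_eq)
      show "AE x in PiM V M. 0 < (\<Prod>w\<in>V. ennreal (h w (x w))) * ennreal (tilt x)"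
        using h(2) tilt_pos fin by (intro AE_I2) (auto simp: zero_less_iff_neq_zero ennreal_eq_0_iff not_le)
      show "(\<lambda>x. (\<Prod>w\<in>V. ennreal (h w (x w))) * ennreal (tilt x)) \<in> borel_measurable (PiM V M)"
        by (intro borel_measurable_times_ennreal H_measurable
            measurable_compose[OF tilt_measurable measurable_ennreal])
    qed
    have transfer: "subvector_cond_indep M law A B C \<longleftrightarrow> subvector_cond_indep N law A B C"
      if "A \<subseteq> V" "B \<subseteq> V" "C \<subseteq> V" for A B C
      using that sets_N by (intro subvector_cond_indep_cong_sets) auto
    have "subvector_cond_indep M law A B C"
      if *: "A \<subseteq> V" "B \<subseteq> V" "C \<subseteq> V" "A \<inter> B = {}" "A \<inter> C = {}" "B \<inter> C = {}" "separates E1 A B C" for A B C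
    proof -
      \<comment> \<open>Separation passes to the subgraph whose only edge is the one along which
        \<open>law\<close> is coupled.\<close>
      have "separates {{u, v}} A B C"
        using *(7) edge by (auto intro: separates_mono)
      then have "\<not> (u \<in> A \<and> v \<in> B)" "\<not> (v \<in> A \<and> u \<in> B)"
        using separates_single_edgeD[OF _ e(2) *(5,6)] by blast+
      \<comment> \<open>As \<open>A\<close> and \<open>B\<close> are disjoint and the edge does not
        join them, one of them avoids both endpoints; symmetry of conditional independence handles
        the case where it is \<open>A\<close>.\<close>
      with *(4) consider "u \<notin> B" "v \<notin> B" | "u \<notin> A" "v \<notin> A" by blast
      then have "subvector_cond_indep N law A B C"
      proof cases
        case 1
        with * show ?thesis by (intro subvector_cond_indep_law) auto
      next
        case 2
        with * have "subvector_cond_indep N law B A C" by (intro subvector_cond_indep_law) auto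
        then show ?thesis
          unfolding subvector_cond_indep_def by (rule prob_space.cond_indep_rv_commute[OF prob_space_law])
      qed
      with * show ?thesis by (simp add: transfer)
    qed
    with \<open>law \<in> positive_laws V M\<close> have "law \<in> ug_model V M E1"
      by (simp add: ug_model_def)
    with sub have "law \<in> ug_model V M E2" by blast
    then have "separates E2 {u} {v} (V - {u, v}) \<longrightarrow> subvector_cond_indep M law {u} {v} (V - {u, v})"
      unfolding ug_model_def mem_Collect_eq
      using edge(1,2) e(2) by (elim conjE allE[of _ "{u}"] allE[of _ "{v}"] allE[of _ "V - {u, v}"]) auto
    then have "subvector_cond_indep M law {u} {v} (V - {u, v})"
      using separates_non_adjacent[OF E(2) e(2) edge(4)] by blast
    then have "subvector_cond_indep N law {u} {v} (V - {u, v})"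
      using edge by (simp add: transfer)
    then show False
      using not_subvector_cond_indep_law[of "V - {u, v}"] S_good(2,3)[OF edge(1)] S_good(2,3)[OF edge(2)] edge
      by (simp add: N_def)
  qed
qed

theorem theorem2:
  fixes V :: "'v set" and M :: "'v \<Rightarrow> 'a measure"
  assumes "finite V"
    and "\<And>v. v \<in> V \<Longrightarrow> sigma_finite_measure (M v)"
    and "\<And>v. v \<in> V \<Longrightarrow> nondegenerate (M v)"
  shows "partial_order (ug_poset V M)
    \<and> (least (ug_poset V M) {} (carrier (ug_poset V M)) \<and>
       greatest (ug_poset V M) (complete_ug V) (carrier (ug_poset V M)))
    \<and> graded_with_rank (ug_poset V M) card
    \<and> (\<forall>E1\<in>ugraphs V. \<forall>E2\<in>ugraphs V.
         covered_by (ug_poset V M) E1 E2 \<longleftrightarrow> E1 \<subseteq> E2 \<and> card E2 = card E1 + 1)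
    \<and> (lower_semilattice (ug_poset V M) \<and> upper_semilattice (ug_poset V M) \<and>
       lattice (ug_poset V M))
    \<and> (lower_semimodular (ug_poset V M) \<and> upper_semimodular (ug_poset V M))"
proof -
  have "finite (complete_ug V)"
    using \<open>finite V\<close> by (auto simp: complete_ug_def)
  moreover have "ugraphs V = Pow (complete_ug V)"
    by (auto simp: ugraphs_def)
  \<comment> \<open>Model inclusion is now inclusion of edge sets, so every claim becomes a fact
    about the finite powerset of \<open>complete_ug V\<close>.\<close>
  ultimately interpret powerset_order "ug_poset V M" "complete_ug V"
    using ug_model_subset_iff[OF assms]
    by unfold_locales (auto simp: ug_poset_def)
  show ?thesis
    using partial_order least_empty greatest_ground graded_with_rank covered_by_iff_card
      lower_semilattice upper_semilattice lattice lower_semimodular upper_semimodular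
    by (simp add: ugraphs_def)
qed

end
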